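(* Let $F$ be a Ferrers diagram with row and column labels $0,1,\dots,n$ and let $G=G(F)$ be the corresponding Ferrers graph, with sink $0$. The map $\mathcal{E}\mapsto c(\mathcal{E})$ is a bijection from the set of EW-tableaux of shape $F$ to the set $\mathrm{Rec}^m(G)$ of minimal recurrent configurations of the Abelian sandpile model on $G$. Moreover, let $\mathcal{E}$ be an EW-tableau of shape $F$, $c=c(\mathcal{E})$ and $\tau=\Psi(\mathcal{E})$. Then, starting from the configuration $\tilde{c}$, the vertices of $G$ can be toppled in the order of $\tau$, read from left to right (each vertex being unstable at the moment it is toppled), to reach the configuration $c$.
   Context: A Ferrers diagram is a left-aligned array of cells whose row lengths weakly decrease from top to bottom (all rows nonempty). Labels: traverse the southeast border from the northeast corner to the southwest corner and number its unit steps $0,1,\dots,n$, where $n+1$ = (number of rows)+(number of columns); the vertical step at the right end of a row is that row's label, the horizontal step at the bottom of a column is that column's label. The top row has label 0. The Ferrers graph $G(F)$ is the bipartite graph with vertex set $\{0,1,\dots,n\}$ (row labels and column labels), with an edge between row label $r$ and column label $c$ iff $F$ has a cell in row $r$ and column $c$. EW-tableau of shape $F$: a 0/1-filling of $F$ such that (1) the top row is all 1s; (2) every other row has at least one 0; (3) no four cells forming the corners of a rectangle have 0s in two diagonally opposite corners and 1s in the other two. Abelian sandpile model on $G(F)$, with sink $0$: a configuration is a vector $c=(c_1,\dots,c_n)$ of nonnegative integers. Vertex $i\in\{1,\dots,n\}$ is stable if $c_i<d_i$, where $d_i$ is the degree of $i$; a configuration is stable if all its vertices are. An unstable vertex $i$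 may topple: it loses $d_i$ grains and each of its neighbours gains one grain (grains sent to the sink disappear; the sink never topples). Toppling unstable vertices from any configuration $c$ eventually reaches a stable configuration $\sigma(c)$ independent of the order of topplings. For a configuration $c$ let $\tilde c_i=c_i+1$ if $i$ is a column label and $\tilde c_i=c_i$ otherwise. The configuration $c$ is recurrent if $\sigma(\tilde c)=c$. A recurrent configuration is minimal if its total number of grains $\sum_{i=1}^n c_i$ is minimal among all recurrent configurations; $\mathrm{Rec}^m(G)$ is the set of these. For an EW-tableau $\mathcal{E}$ of shape $F$, the configuration $c(\mathcal{E})$ has $c_i$ = the number of 0s in column $i$ if $i$ is a column label, and $c_i$ = the number of 1s in row $i$ if $i\geq 1$ is a row label. The map $\Psi$ from EW-tableaux to permutations of $\{1,\dots,n\}$: delete all entries of the top row and disregard the label 0. Repeat until all labels have been read: (i) write down the labels of all unread columns containing no 1s, from right to left, and delete their entries; (ii) write down the labels of all unread rows containing no 0s, from bottom to top, and delete their entries. *)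

theory Defs
  imports Main "HOL-Library.FuncSet" "HOL-Library.While_Combinator"
begin

text \<open>
  A Ferrers diagram is the list of its row lengths, from top to bottom.  Rows and columns are
  addressed by their positions \<open>0, 1, \<dots>\<close> from the top and from the left; these positions are
  not the labels, which come from the border path below.  The diagram is nonempty, since it
  has a top row.
\<close>

definition ferrers :: "nat list \<Rightarrow> bool" where
  "ferrers F \<longleftrightarrow> F \<noteq> [] \<and> sorted_wrt (\<ge>) F \<and> (\<forall>x\<in>set F. 0 < x)"

definition cells :: "nat list \<Rightarrow> (nat \<times> nat) set" where
  "cells F = {(i, j). i < length F \<and> j < F ! i}"

definition maxlabel :: "nat list \<Rightarrow> nat" where
  "maxlabel F = length F + F ! 0 - 1"

text \<open>
  \<open>Row i\<close> is the vertical border step at the right end of row \<open>i\<close>, \<open>Col j\<close> the horizontal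
  border step at the bottom of column \<open>j\<close>.
\<close>

datatype step = Row nat | Col nat

text \<open>
  The southeast border, from the northeast to the southwest corner: after the vertical step of
  row \<open>i\<close> come, from right to left, the columns that end in row \<open>i\<close>.
\<close>

definition border :: "nat list \<Rightarrow> step list" where
  "border F =
     concat (map (\<lambda>i. Row i # map Col (rev [(F @ [0]) ! Suc i ..< F ! i])) [0..<length F])"

definition label :: "nat list \<Rightarrow> step \<Rightarrow> nat" where
  "label F s = (THE l. l < length (border F) \<and> border F ! l = s)"

definition is_col_label :: "nat list \<Rightarrow> nat \<Rightarrow> bool" where
  "is_col_label F l \<longleftrightarrow> l < length (border F) \<and> (\<exists>j. border F ! l = Col j)"

lemma "border [4, 2, 2] = [Row 0, Col 3, Col 2, Row 1, Row 2, Col 1, Col 0]"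
  by (simp add: border_def upt_conv_Cons)


text \<open>A simple graph is given by its vertices and its edges (two-element vertex sets).\<close>

type_synonym graph = "nat set \<times> nat set set"

definition ferrers_graph :: "nat list \<Rightarrow> graph" where
  "ferrers_graph F =
     ({0..maxlabel F}, {{label F (Row i), label F (Col j)} | i j. (i, j) \<in> cells F})"

definition nbrs :: "graph \<Rightarrow> nat \<Rightarrow> nat set" where
  "nbrs G v = {u \<in> fst G. {u, v} \<in> snd G}"

definition degree :: "graph \<Rightarrow> nat \<Rightarrow> nat" where
  "degree G v = card (nbrs G v)"


text \<open>
  The sandpile model with sink \<open>0\<close>.  A configuration lives on the non-sink vertices only; as a
  function on all of \<^typ>\<open>nat\<close> it is extensional, so that it is determined by these values.
\<close>

definition configs :: "graph \<Rightarrow> (nat \<Rightarrow> nat) set" where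
  "configs G = (fst G - {0}) \<rightarrow>\<^sub>E UNIV"

definition stable :: "graph \<Rightarrow> (nat \<Rightarrow> nat) \<Rightarrow> bool" where
  "stable G c \<longleftrightarrow> (\<forall>v \<in> fst G - {0}. c v < degree G v)"

definition topple :: "graph \<Rightarrow> nat \<Rightarrow> (nat \<Rightarrow> nat) \<Rightarrow> nat \<Rightarrow> nat" where
  "topple G v c = (\<lambda>u. if u = v then c u - degree G v
                       else if u \<in> nbrs G v - {0} then c u + 1
                       else c u)"

text \<open>
  \<open>topples G c vs c'\<close>: from \<open>c\<close> the vertices \<open>vs\<close> can be toppled in the given order, each one
  being unstable when it is toppled, and this results in \<open>c'\<close>.
\<close>

inductive topples :: "graph \<Rightarrow> (nat \<Rightarrow> nat) \<Rightarrow> nat list \<Rightarrow> (nat \<Rightarrow> nat) \<Rightarrow> bool" for G where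
  Nil: "topples G c [] c"
| Cons: "v \<in> fst G - {0} \<Longrightarrow> degree G v \<le> c v \<Longrightarrow> topples G (topple G v c) vs c'
           \<Longrightarrow> topples G c (v # vs) c'"

definition stabilization :: "graph \<Rightarrow> (nat \<Rightarrow> nat) \<Rightarrow> nat \<Rightarrow> nat" where
  "stabilization G c = (THE c'. stable G c' \<and> (\<exists>vs. topples G c vs c'))"

definition tilde :: "nat list \<Rightarrow> (nat \<Rightarrow> nat) \<Rightarrow> nat \<Rightarrow> nat" where
  "tilde F c = (\<lambda>l. if is_col_label F l then c l + 1 else c l)"

definition recurrent :: "nat list \<Rightarrow> (nat \<Rightarrow> nat) set" where
  "recurrent F =
     {c \<in> configs (ferrers_graph F). stabilization (ferrers_graph F) (tilde F c) = c}"

definition minimal_recurrent :: "nat list \<Rightarrow> (nat \<Rightarrow> nat) set" where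
  "minimal_recurrent F =
     {c \<in> recurrent F. \<forall>c' \<in> recurrent F. sum c {1..maxlabel F} \<le> sum c' {1..maxlabel F}}"


definition EW_tableaux :: "nat list \<Rightarrow> (nat \<times> nat \<Rightarrow> nat) set" where
  "EW_tableaux F =
     {T \<in> cells F \<rightarrow>\<^sub>E {0, 1}.
        (\<forall>j < F ! 0. T (0, j) = 1) \<and>
        (\<forall>i. 0 < i \<and> i < length F \<longrightarrow> (\<exists>j < F ! i. T (i, j) = 0)) \<and>
        \<not> (\<exists>i i' j j'. i \<noteq> i' \<and> j \<noteq> j' \<and>
              {(i, j), (i, j'), (i', j), (i', j')} \<subseteq> cells F \<and>
              T (i, j) = 0 \<and> T (i', j') = 0 \<and> T (i, j') = 1 \<and> T (i', j) = 1)}"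

definition config_of :: "nat list \<Rightarrow> (nat \<times> nat \<Rightarrow> nat) \<Rightarrow> nat \<Rightarrow> nat" where
  "config_of F T = (\<lambda>l \<in> {1..maxlabel F}.
     case border F ! l of
       Row i \<Rightarrow> card {j. (i, j) \<in> cells F \<and> T (i, j) = 1}
     | Col j \<Rightarrow> card {i. (i, j) \<in> cells F \<and> T (i, j) = 0})"

text \<open>
  A state of the reading procedure consists of the unread rows (listed from bottom to top), the
  unread columns (listed from right to left), both by position, and the labels written so far.
  The entries not yet deleted are those in an unread row and an unread column.
\<close>

definition Psi_round ::
  "nat list \<Rightarrow> (nat \<times> nat \<Rightarrow> nat) \<Rightarrow> nat list \<times> nat list \<times> nat list
     \<Rightarrow> nat list \<times> nat list \<times> nat list" where
  "Psi_round F T = (\<lambda>(rs, cs, w).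
     let no1 = (\<lambda>j. \<forall>i \<in> set rs. (i, j) \<in> cells F \<longrightarrow> T (i, j) \<noteq> 1);
         cs' = filter (\<lambda>j. \<not> no1 j) cs;
         no0 = (\<lambda>i. \<forall>j \<in> set cs'. (i, j) \<in> cells F \<longrightarrow> T (i, j) \<noteq> 0);
         rs' = filter (\<lambda>i. \<not> no0 i) rs
     in (rs', cs', w @ map (\<lambda>j. label F (Col j)) (filter no1 cs)
                     @ map (\<lambda>i. label F (Row i)) (filter no0 rs)))"

text \<open>The top row, position \<open>0\<close>, is deleted and its label disregarded from the start.\<close>

definition Psi :: "nat list \<Rightarrow> (nat \<times> nat \<Rightarrow> nat) \<Rightarrow> nat list" where
  "Psi F T = snd (snd
     (while (\<lambda>(rs, cs, w). rs \<noteq> [] \<or> cs \<noteq> [])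
        (Psi_round F T)
        (rev [1..<length F], rev [0..<F ! 0], [])))"

end

theory Submission
  imports Defs
begin

text \<open>
  A tableau is read as an orientation of the Ferrers graph: a \<open>1\<close> is an arrow from its row to its
  column, a \<open>0\<close> an arrow from its column to its row. The entries of \<open>c(T)\<close> are then the
  out-degrees of the vertices other than the sink. A top row of \<open>1\<close>s makes the sink a source, a
  \<open>0\<close> in each other row makes it the only source, and the forbidden rectangles are the directed
  4-cycles. In a Ferrers graph the absence of directed 4-cycles already excludes all directed
  cycles (\<open>EW_subtableau_column\<close>), so that the reading \<open>\<Psi>\<close> never gets stuck: it peels off sources
  until nothing is left, and its result is a topological order (\<open>Psi_order\<close>).

  Adding a grain to each column is a firing of the sink. If the vertices are then toppled along a
  topological order, a vertex has received one grain over each incoming arrow when its turn comes;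
  together with its out-degree this is exactly its degree, so that it is unstable. Once all
  vertices have been toppled, each has received and lost its degree, and the configuration is back
  (\<open>outdegree_topples\<close>). As stabilization is unique, \<open>c(T)\<close> is recurrent.

  Conversely, if \<open>c\<close> is recurrent, every vertex topples exactly once on the way from the enriched
  configuration back to \<open>c\<close> (\<open>recurrent_topples_once\<close>). Orienting every edge from the vertex that
  topples first to the other one gives an EW-tableau \<open>T\<close>, and legality of the topplings says
  precisely that \<open>c\<close> is at least \<open>c(T)\<close> everywhere (\<open>recurrent_dominates_tableau\<close>). The total
  of \<open>c(T)\<close> counts the edges away from the sink, which is the same number for all tableaux. Hence
  the configurations \<open>c(T)\<close> are minimal, and a minimal \<open>c\<close> must be equal to the \<open>c(T)\<close> below it.

  Injectivity holds because an acyclic orientation is determined by its out-degrees: along a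
  topological order of one orientation, the incoming arrows of each vertex are forced in the other
  (\<open>outdegrees_determine_orientation\<close>).
\<close>

section \<open>Positions in lists\<close>

lemma count_list_distinct: "distinct xs \<Longrightarrow> count_list xs v = (if v \<in> set xs then 1 else 0)"
  by (induction xs) auto

lemma length_takeWhile_neq: "u \<in> set xs \<Longrightarrow> length (takeWhile (\<lambda>x. x \<noteq> u) xs) < length xs"
  by (induction xs) auto

text \<open>
  This turns a toppling order into comparisons of numbers. The witness is the index of the first
  occurrence.
\<close>

lemma distinct_list_position:
  assumes "distinct xs"
  shows "\<exists>p :: 'a \<Rightarrow> nat. \<forall>as v bs u. xs = as @ v # bs \<longrightarrow> u \<in> set as \<longrightarrow> p u < p v"
proof (intro exI allI impI)
  fix as v bs u assume xs: "xs = as @ v # bs" and u: "u \<in> set as"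
  have "v \<notin> set as" using assms xs by simp
  hence "takeWhile (\<lambda>x. x \<noteq> v) xs = as" unfolding xs by (subst takeWhile_append2) auto
  moreover have "takeWhile (\<lambda>x. x \<noteq> u) xs = takeWhile (\<lambda>x. x \<noteq> u) as"
    unfolding xs using u by (subst takeWhile_append1) auto
  ultimately show "length (takeWhile (\<lambda>x. x \<noteq> u) xs) < length (takeWhile (\<lambda>x. x \<noteq> v) xs)"
    using length_takeWhile_neq[OF u] by simp
qed

section \<open>Toppling on a graph with a sink\<close>

text \<open>
  The axiom \<open>near_sink\<close> is a strong form of connectedness. A Ferrers graph satisfies it because
  every column meets the top row, and it makes available an explicit superharmonic function, on which the
  termination of toppling is based.
\<close>

locale sink_graph =
  fixes G :: graph
  assumes finite_vertices: "finite (fst G)"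
    and sink_vertex: "0 \<in> fst G"
    and loopless: "v \<notin> nbrs G v"
    and near_sink: "v \<in> fst G - {0} \<Longrightarrow> v \<in> nbrs G 0 \<or> (\<exists>u \<in> nbrs G v. u \<in> nbrs G 0)"
begin

abbreviation "V \<equiv> fst G - {0}"
abbreviation "N \<equiv> nbrs G"
abbreviation "d \<equiv> degree G"

lemma nbrs_vertex: "u \<in> N v \<Longrightarrow> u \<in> fst G"
  by (simp add: nbrs_def)

lemma nbrs_sym: "u \<in> N v \<Longrightarrow> v \<in> fst G \<Longrightarrow> v \<in> N u"
  by (simp add: nbrs_def insert_commute)

lemma finite_nbrs [simp]: "finite (N v)"
  using finite_vertices by (simp add: nbrs_def)

lemma degree_pos: "v \<in> V \<Longrightarrow> 0 < d v"
  using near_sink[of v] nbrs_sym[of v 0] sink_vertex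
  by (auto simp: degree_def card_gt_0_iff)

lemma topples_vertices: "topples G c vs c' \<Longrightarrow> set vs \<subseteq> V"
  by (induction rule: topples.induct) auto

lemma topples_outside:
  assumes "topples G c vs c'" "u \<notin> V"
  shows "c' u = c u"
  using assms
  by (induction rule: topples.induct) (auto simp: topple_def dest: nbrs_vertex)

text \<open>
  Conservation of grains: only the number of topplings of each vertex matters for the result, not
  their order.
\<close>

lemma topples_balance:
  assumes "topples G c vs c'" "u \<in> V"
  shows "c' u + d u * count_list vs u = c u + (\<Sum>w \<in> N u. count_list vs w)"
  using assms
proof (induction rule: topples.induct)
  case (Cons v c vs c')
  show ?case
  proof (cases "u = v")
    case True
    have "(\<Sum>w \<in> N u. count_list (v # vs) w) = (\<Sum>w \<in> N u. count_list vs w)"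
      using True loopless by (intro sum.cong) auto
    with Cons True show ?thesis by (simp add: topple_def)
  next
    case False
    have "(\<Sum>w \<in> N u. count_list (v # vs) w)
        = (\<Sum>w \<in> N u. (if w = v then 1 else 0) + count_list vs w)"
      by (intro sum.cong) auto
    also have "\<dots> = (if v \<in> N u then 1 else 0) + (\<Sum>w \<in> N u. count_list vs w)"
      by (simp add: sum.distrib sum.delta)
    finally show ?thesis
      using Cons False nbrs_sym[of v u] nbrs_sym[of u v] by (auto simp: topple_def)
  qed
qed simp

lemma topples_Nil_iff: "topples G c [] c' \<longleftrightarrow> c' = c"
  by (auto intro: topples.Nil elim: topples.cases)

lemma topples_Cons_iff:
  "topples G c (v # vs) c' \<longleftrightarrow> v \<in> V \<and> d v \<le> c v \<and> topples G (topple G v c) vs c'"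
  by (subst topples.simps) auto

lemma topples_append:
  "topples G c (xs @ ys) c' \<longleftrightarrow> (\<exists>b. topples G c xs b \<and> topples G b ys c')"
  by (induction xs arbitrary: c) (auto simp: topples_Nil_iff topples_Cons_iff)

lemma topples_single: "topples G c [v] c' \<longleftrightarrow> v \<in> V \<and> d v \<le> c v \<and> c' = topple G v c"
  by (simp add: topples_Nil_iff topples_Cons_iff)

text \<open>
  The least action principle: let toppling each vertex \<open>v\<close> formally \<open>x v\<close> times leave every vertex
  below its degree. The first toppling of a legal sequence that exceeds the bound \<open>x\<close> at some \<open>v\<close>
  would happen when \<open>v\<close> has toppled \<open>x v\<close> times and its neighbours at most as often as in \<open>x\<close>; at
  that moment \<open>v\<close> is stable.
\<close>

lemma least_action:
  assumes "topples G c vs c'"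
    and x: "\<And>v. v \<in> V \<Longrightarrow> c v + (\<Sum>u \<in> N v - {0}. x u) < d v * (x v + 1)"
    and "v \<in> V"
  shows "count_list vs v \<le> x v"
  using assms(1,3)
proof (induction vs arbitrary: v c' rule: rev_induct)
  case (snoc w vs)
  then obtain b where b: "topples G c vs b" "w \<in> V" "d w \<le> b w"
    by (auto simp: topples_append topples_single)
  show ?case
  proof (cases "v = w")
    case True
    have "count_list vs 0 = 0"
      using topples_vertices[OF b(1)] by (auto simp: count_list_0_iff)
    hence "(\<Sum>u \<in> N w. count_list vs u) = (\<Sum>u \<in> N w - {0}. count_list vs u)"
      by (intro sum.mono_neutral_right) auto
    also have "\<dots> \<le> (\<Sum>u \<in> N w - {0}. x u)"
      using snoc.IH[OF b(1)] nbrs_vertex by (intro sum_mono) auto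
    finally have "b w + d w * count_list vs w < d w * (x w + 1)"
      using topples_balance[OF b(1,2)] x[OF b(2)] by linarith
    hence "d w * (count_list vs w + 1) < d w * (x w + 1)"
      using b(3) unfolding distrib_left by linarith
    hence "count_list vs w < x w" by (simp only: mult_less_cancel1 add_less_cancel_right)
    thus ?thesis using True by simp
  next
    case False
    thus ?thesis using snoc.IH[OF b(1)] snoc.prems by simp
  qed
qed simp

lemma stable_dominates:
  assumes "topples G c vs c'" "stable G c'" "topples G c ws c''" "v \<in> V"
  shows "count_list ws v \<le> count_list vs v"
proof (rule least_action[OF assms(3) _ assms(4)])
  fix v assume v: "v \<in> V"
  have "(\<Sum>u \<in> N v - {0}. count_list vs u) \<le> (\<Sum>u \<in> N v. count_list vs u)"
    by (intro sum_mono2) auto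
  thus "c v + (\<Sum>u \<in> N v - {0}. count_list vs u) < d v * (count_list vs v + 1)"
    using topples_balance[OF assms(1) v] bspec[OF assms(2)[unfolded stable_def] v]
    unfolding distrib_left by linarith
qed

lemma stable_unique:
  assumes "topples G c vs c'" "stable G c'" "topples G c ws c''" "stable G c''"
  shows "c' = c''"
proof
  fix u
  have eq: "count_list vs v = count_list ws v" for v
  proof (cases "v \<in> V")
    case True
    thus ?thesis using stable_dominates assms by (meson le_antisym)
  next
    case False
    thus ?thesis using topples_vertices assms(1,3) by (metis count_notin subset_iff)
  qed
  show "c' u = c'' u"
  proof (cases "u \<in> V")
    case True
    thus ?thesis
      using topples_balance[OF assms(1) True] topples_balance[OF assms(3) True] by (simp add: eq)
  qed (use topples_outside assms in metis)
qed

text \<open>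
  The function is \<open>card (fst G)\<close> next to the sink and larger by \<open>1\<close> elsewhere. Next to the sink the
  inequality holds because one of the at most \<open>card (fst G)\<close> summands is missing, elsewhere because
  some neighbour is next to the sink.
\<close>

lemma superharmonic:
  defines "y \<equiv> (\<lambda>v. card (fst G) + (if v \<in> N 0 then 0 else 1))"
  assumes v: "v \<in> V"
  shows "(\<Sum>u \<in> N v - {0}. y u) < d v * y v"
proof (cases "v \<in> N 0")
  case True
  hence 0: "0 \<in> N v" using nbrs_sym sink_vertex by blast
  have dv: "d v \<le> card (fst G)"
    unfolding degree_def by (intro card_mono finite_vertices) (auto simp: nbrs_def)
  have "(\<Sum>u \<in> N v - {0}. y u) \<le> (\<Sum>u \<in> N v - {0}. card (fst G) + 1)"
    by (intro sum_mono) (simp add: y_def)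
  also have "\<dots> = (d v - 1) * (card (fst G) + 1)" using 0 by (simp add: degree_def)
  also have "\<dots> < d v * card (fst G)"
  proof -
    obtain k where k: "d v = Suc k" using degree_pos[OF v] by (cases "d v") auto
    show ?thesis using dv k by simp
  qed
  finally show ?thesis using True by (simp add: y_def)
next
  case False
  then obtain w where w: "w \<in> N v" "w \<in> N 0" using near_sink v by blast
  have "0 \<notin> N v" using False nbrs_sym v by blast
  hence "(\<Sum>u \<in> N v - {0}. y u) = (\<Sum>u \<in> N v. y u)" by simp
  also have "\<dots> < (\<Sum>u \<in> N v. card (fst G) + 1)"
    using w by (intro sum_strict_mono_ex1) (auto simp: y_def)
  also have "\<dots> = d v * y v" using False by (simp add: degree_def y_def)
  finally show ?thesis .
qed

text \<open>
  A large multiple of the superharmonic function satisfies the hypothesis of the least action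
  principle and so bounds the length of every legal sequence. A longest one ends in a stable
  configuration.
\<close>

lemma stabilizes: "\<exists>vs c'. topples G c vs c' \<and> stable G c'"
proof -
  define y where "y = (\<lambda>v. card (fst G) + (if v \<in> N 0 then 0 else 1))"
  \<comment> \<open>The factor compensates for the grains that are present at the start.\<close>
  define K where "K = (\<Sum>v \<in> V. c v)"
  have x: "c v + (\<Sum>u \<in> N v - {0}. K * y u) < d v * (K * y v + 1)" if v: "v \<in> V" for v
  proof -
    have "c v \<le> K" unfolding K_def using v finite_vertices by (intro member_le_sum) auto
    moreover have "(\<Sum>u \<in> N v - {0}. y u) + 1 \<le> d v * y v"
      using superharmonic[OF v] by (simp add: y_def)
    hence "K * ((\<Sum>u \<in> N v - {0}. y u) + 1) \<le> K * (d v * y v)" by (rule mult_le_mono2)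
    ultimately show ?thesis
      using degree_pos[OF v] by (simp add: sum_distrib_left algebra_simps)
  qed
  define P where "P = (\<lambda>vs. \<exists>c'. topples G c vs c')"
  have bound: "length vs \<le> (\<Sum>v \<in> V. K * y v)" if "P vs" for vs
  proof -
    from that obtain c' where c': "topples G c vs c'" unfolding P_def ..
    have "length vs = (\<Sum>v \<in> set vs. count_list vs v)" by (simp add: sum_count_set)
    also have "\<dots> \<le> (\<Sum>v \<in> V. count_list vs v)"
      using topples_vertices[OF c'] finite_vertices by (intro sum_mono2) auto
    also have "\<dots> \<le> (\<Sum>v \<in> V. K * y v)"
      using least_action[OF c', of "\<lambda>v. K * y v"] x by (intro sum_mono) blast
    finally show ?thesis .
  qed
  have "P []" unfolding P_def by (blast intro: topples.Nil)
  then obtain vs where vs: "P vs" and max: "\<And>ws. P ws \<Longrightarrow> length ws \<le> length vs"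
    using ex_has_greatest_nat[of P "[]" length "Suc (\<Sum>v \<in> V. K * y v)"] bound
    by (auto simp: less_Suc_eq_le)
  from vs obtain c' where c': "topples G c vs c'" unfolding P_def ..
  have "stable G c'"
    unfolding stable_def
  proof (intro ballI, rule ccontr)
    fix v assume "v \<in> V" "\<not> c' v < d v"
    hence "topples G c (vs @ [v]) (topple G v c')"
      using c' unfolding topples_append topples_single by auto
    hence "P (vs @ [v])" unfolding P_def by (rule exI[of _ "topple G v c'"])
    thus False using max[of "vs @ [v]"] by simp
  qed
  thus ?thesis using c' by blast
qed

lemma stabilization_eqI:
  assumes "topples G c vs c'" "stable G c'"
  shows "stabilization G c = c'"
  unfolding stabilization_def using assms stable_unique by (intro the_equality) blast+

lemma stabilization_reached:
  "stable G (stabilization G c) \<and> (\<exists>vs. topples G c vs (stabilization G c))"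
  using stabilizes[of c] stabilization_eqI by metis

text \<open>
  The sink has no grains of its own; its firing only adds a grain to each of its neighbours.
\<close>

definition fire_sink :: "(nat \<Rightarrow> nat) \<Rightarrow> nat \<Rightarrow> nat" where
  "fire_sink c = (\<lambda>v. if v \<in> N 0 then c v + 1 else c v)"

lemma card_nbrs_sink:
  assumes "v \<in> V"
  shows "card (N v) = card (N v - {0}) + (if v \<in> N 0 then 1 else 0)"
proof (cases "v \<in> N 0")
  case True
  hence "0 \<in> N v" using nbrs_sym sink_vertex by blast
  thus ?thesis using True card.remove[of "N v" 0] by simp
next
  case False
  hence "0 \<notin> N v" using nbrs_sym assms by blast
  thus ?thesis using False by simp
qed

lemma sum_count_distinct:
  "distinct xs \<Longrightarrow> (\<Sum>w \<in> N v. count_list xs w) = card (N v \<inter> set xs)"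
  by (simp add: count_list_distinct sum.If_cases)

text \<open>
  Toppling every vertex once undoes the firing of the sink, so that by the least action principle no
  vertex topples twice. A vertex that never topples loses nothing and, ending with
  what it had before the sink fired, gains nothing: it is not next to the sink, and none of its
  neighbours topples, although one of them is next to the sink.
\<close>

lemma recurrent_topples_once:
  assumes tc: "topples G (fire_sink c) vs c" and st: "stable G c"
  shows "distinct vs \<and> set vs = V"
proof
  have "count_list vs v \<le> 1" if "v \<in> V" for v
  proof (rule least_action[OF tc _ that])
    fix v assume v: "v \<in> V"
    have "fire_sink c v + card (N v - {0}) = c v + d v"
      using card_nbrs_sink[OF v] by (simp add: fire_sink_def degree_def)
    thus "fire_sink c v + (\<Sum>u \<in> N v - {0}. 1) < d v * (1 + 1)"
      using st v by (fastforce simp: stable_def)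
  qed
  hence "count_list vs v \<le> 1" for v
    using topples_vertices[OF tc] by (cases "v \<in> set vs") (blast, simp)
  thus "distinct vs"
  proof (induction vs)
    case (Cons a vs)
    have "count_list vs v \<le> 1" for v using Cons.prems[of v] by (auto split: if_splits)
    moreover have "a \<notin> set vs" using Cons.prems[of a] by (auto simp: count_list_0_iff)
    ultimately show ?case using Cons.IH by simp
  qed simp
  have zero: "v \<notin> N 0 \<and> N v \<inter> set vs = {}" if v: "v \<in> V" and nv: "v \<notin> set vs" for v
  proof -
    have "c v = fire_sink c v + (\<Sum>w \<in> N v. count_list vs w)"
      using topples_balance[OF tc v] nv by (simp add: count_notin)
    hence "v \<notin> N 0" "(\<Sum>w \<in> N v. count_list vs w) = 0"
      by (auto simp: fire_sink_def split: if_splits)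
    thus ?thesis by (auto simp: count_list_0_iff)
  qed
  have "v \<in> set vs" if v: "v \<in> V" for v
  proof (rule ccontr)
    assume nv: "v \<notin> set vs"
    then obtain u where u: "u \<in> N v" "u \<in> N 0" using near_sink[OF v] zero[OF v] by blast
    hence "u \<in> V" using nbrs_vertex loopless by blast
    thus False using zero[of u] zero[OF v nv] u by blast
  qed
  thus "set vs = V" using topples_vertices[OF tc] by blast
qed


section \<open>Orientations and toppling orders\<close>

text \<open>
  \<open>P v\<close> is the set of the vertices from which an arrow leads to \<open>v\<close>. The sink is a source.
\<close>

definition orientation :: "(nat \<Rightarrow> nat set) \<Rightarrow> bool" where
  "orientation P \<longleftrightarrow> P 0 = {} \<and>
     (\<forall>v \<in> fst G. P v \<subseteq> N v \<and> (\<forall>u \<in> N v. u \<in> P v \<longleftrightarrow> v \<notin> P u))"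

text \<open>
  \<open>vs\<close>, preceded by the sink, is an initial segment of a topological order.
\<close>

definition admissible :: "(nat \<Rightarrow> nat set) \<Rightarrow> nat list \<Rightarrow> bool" where
  "admissible P vs \<longleftrightarrow> (\<forall>xs v ys. vs = xs @ v # ys \<longrightarrow> P v \<subseteq> insert 0 (set xs))"

lemma orientation_sink: "orientation P \<Longrightarrow> P 0 = {}"
  unfolding orientation_def by blast

lemma orientation_subset: "orientation P \<Longrightarrow> v \<in> fst G \<Longrightarrow> P v \<subseteq> N v"
  unfolding orientation_def by blast

lemma orientation_flip:
  "orientation P \<Longrightarrow> v \<in> fst G \<Longrightarrow> u \<in> N v \<Longrightarrow> u \<in> P v \<longleftrightarrow> v \<notin> P u"
  unfolding orientation_def by blast

lemma admissible_prefix: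
  "admissible P vs \<Longrightarrow> vs = xs @ v # ys \<Longrightarrow> P v \<subseteq> insert 0 (set xs)"
  unfolding admissible_def by blast

lemma admissible_append:
  assumes "admissible P xs" and "\<And>v. v \<in> set ys \<Longrightarrow> P v \<subseteq> insert 0 (set xs)"
  shows "admissible P (xs @ ys)"
  unfolding admissible_def
proof (intro allI impI)
  fix as v bs assume eq: "xs @ ys = as @ v # bs"
  show "P v \<subseteq> insert 0 (set as)"
  proof (cases "length as < length xs")
    case True
    hence "xs = as @ v # take (length xs - Suc (length as)) bs"
      using arg_cong[OF eq, of "take (length xs)"]
      by (simp add: take_Cons' Suc_diff_Suc)
    thus ?thesis using admissible_prefix[OF assms(1)] by blast
  next
    case False
    have "v = (xs @ ys) ! length as" "length as < length (xs @ ys)" unfolding eq by simp_all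
    hence "v \<in> set ys" using False by (simp add: nth_append)
    moreover have "xs = take (length xs) as"
      using False arg_cong[OF eq, of "take (length xs)"] by simp
    hence "set xs \<subseteq> set as" using set_take_subset by metis
    ultimately show ?thesis using assms(2) by blast
  qed
qed

lemma card_orientation:
  assumes "orientation P" "v \<in> fst G"
  shows "d v = card (P v) + card (N v - P v)"
  using orientation_subset[OF assms] card_Int_Diff[of "N v" "P v"]
  by (simp add: degree_def Int_absorb1)

text \<open>
  When the turn of \<open>v\<close> comes, all of \<open>P v\<close> has fired, the sink included. With these grains the
  out-degree of \<open>v\<close> is raised to at least its degree.
\<close>

lemma outdegree_topples:
  assumes P: "orientation P" and ad: "admissible P vs"
    and vs: "distinct vs" "set vs = V"
    and c: "\<And>v. v \<in> V \<Longrightarrow> c v = card (N v - P v)"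
  shows "topples G (fire_sink c) vs c"
proof -
  have prefix: "\<exists>b. topples G (fire_sink c) xs b" if "vs = xs @ ys" for xs ys
    using that
  proof (induction xs arbitrary: ys rule: rev_induct)
    case Nil
    show ?case by (blast intro: topples.Nil)
  next
    case (snoc v xs)
    then obtain b where b: "topples G (fire_sink c) xs b" by auto
    have v: "v \<in> V" "v \<notin> set xs" "distinct xs" using vs snoc.prems by auto
    have bv: "b v = fire_sink c v + card (N v \<inter> set xs)"
      using topples_balance[OF b v(1)] v by (simp add: sum_count_distinct count_notin)
    have "P v \<subseteq> insert 0 (set xs)"
      using admissible_prefix[OF ad, of xs v ys] snoc.prems by simp
    moreover have "P v \<subseteq> N v" using orientation_subset[OF P] v by blast
    ultimately have sub: "P v \<subseteq> (N v \<inter> {0}) \<union> (N v \<inter> set xs)" by blast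
    have "card (P v) \<le> card (N v \<inter> {0}) + card (N v \<inter> set xs)"
      using card_mono[OF _ sub] card_Un_le[of "N v \<inter> {0}" "N v \<inter> set xs"] by simp
    moreover have "card (N v \<inter> {0}) \<le> (if v \<in> N 0 then 1 else 0)"
      using nbrs_sym[of 0 v] v card_mono[of "{0}" "N v \<inter> {0}"] by auto
    ultimately have "d v \<le> b v"
      using bv card_orientation[OF P] c v by (auto simp: fire_sink_def)
    thus ?case using b v(1) by (auto simp: topples_append topples_single)
  qed
  obtain b where b: "topples G (fire_sink c) vs b" using prefix[of vs "[]"] by auto
  have "b = c"
  proof
    fix u
    show "b u = c u"
    proof (cases "u \<in> V")
      case True
      have "N u \<inter> V = N u - {0}" using nbrs_vertex by blast
      hence "(\<Sum>w \<in> N u. count_list vs w) = card (N u - {0})"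
        using sum_count_distinct[OF vs(1), of u] vs(2) by simp
      moreover have "count_list vs u = 1"
        using vs True count_list_distinct[of vs u] by simp
      ultimately have "b u + card (N u) = fire_sink c u + card (N u - {0})"
        using topples_balance[OF b True] by (simp add: degree_def)
      thus ?thesis using card_nbrs_sink[OF True] by (simp add: fire_sink_def split: if_splits)
    next
      case False
      hence "u \<notin> N 0" using nbrs_vertex loopless by blast
      thus ?thesis using topples_outside[OF b False] by (simp add: fire_sink_def)
    qed
  qed
  with b show ?thesis by simp
qed

text \<open>
  Every edge is an incoming arrow of one end and an outgoing arrow of the other.
\<close>

lemma orientation_sum_outdegrees:
  assumes "orientation P"
  shows "2 * (\<Sum>v \<in> fst G. card (N v - P v)) = (\<Sum>v \<in> fst G. d v)"
proof -
  note sub = orientation_subset[OF assms] and flip = orientation_flip[OF assms]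
  have "(\<Sum>v \<in> fst G. card (P v)) = (\<Sum>v \<in> fst G. \<Sum>u \<in> fst G. if u \<in> P v then 1 else 0)"
  proof (intro sum.cong refl)
    fix v assume "v \<in> fst G"
    hence "fst G \<inter> P v = P v" using sub nbrs_vertex by blast
    thus "card (P v) = (\<Sum>u \<in> fst G. if u \<in> P v then 1 else 0)"
      using finite_vertices by (simp add: sum.If_cases)
  qed
  also have "\<dots> = (\<Sum>u \<in> fst G. \<Sum>v \<in> fst G. if u \<in> P v then 1 else 0)"
    by (rule sum.swap)
  also have "\<dots> = (\<Sum>u \<in> fst G. card (N u - P u))"
  proof (intro sum.cong refl)
    fix u assume u: "u \<in> fst G"
    have "{v \<in> fst G. u \<in> P v} = N u - P u"
    proof (intro equalityI subsetI)
      fix v assume "v \<in> {v \<in> fst G. u \<in> P v}"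
      hence v: "v \<in> fst G" "u \<in> P v" by simp_all
      hence "v \<in> N u" using sub nbrs_sym by blast
      thus "v \<in> N u - P u" using flip[OF u, of v] v by blast
    next
      fix v assume "v \<in> N u - P u"
      thus "v \<in> {v \<in> fst G. u \<in> P v}" using flip[OF u, of v] nbrs_vertex[of v u] by blast
    qed
    thus "(\<Sum>v \<in> fst G. if u \<in> P v then 1 else 0) = card (N u - P u)"
      using finite_vertices by (simp add: sum.If_cases Int_def)
  qed
  finally have "(\<Sum>v \<in> fst G. card (P v)) = (\<Sum>v \<in> fst G. card (N v - P v))" .
  moreover have "(\<Sum>v \<in> fst G. d v) = (\<Sum>v \<in> fst G. card (P v) + card (N v - P v))"
    by (intro sum.cong refl card_orientation[OF assms])
  ultimately show ?thesis by (simp add: sum.distrib)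
qed

text \<open>
  Both sums count the edges that avoid the sink, as all edges at the sink are directed away from it.
\<close>

lemma sum_outdegrees_eq:
  assumes "orientation P" "orientation P'"
  shows "(\<Sum>v \<in> V. card (N v - P v)) = (\<Sum>v \<in> V. card (N v - P' v))"
proof -
  have "(\<Sum>v \<in> fst G. card (N v - Q v)) = card (N 0) + (\<Sum>v \<in> V. card (N v - Q v))"
    if "orientation Q" for Q
    using orientation_sink[OF that]
      sum.remove[OF finite_vertices sink_vertex, of "\<lambda>v. card (N v - Q v)"]
    by simp
  thus ?thesis
    using orientation_sum_outdegrees[OF assms(1)] orientation_sum_outdegrees[OF assms(2)]
      assms by simp
qed

text \<open>
  Go through the vertices in the topological order \<open>vs\<close> of \<open>P\<close>. If \<open>P\<close> and \<open>P'\<close> agree before \<open>w\<close>,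
  then an edge from \<open>u \<in> P w\<close> cannot be directed towards \<open>u\<close> in \<open>P'\<close>, because \<open>u\<close> comes earlier
  and \<open>w \<notin> P u = P' u\<close>. So \<open>P w\<close> is contained in \<open>P' w\<close>, and both sets have the same size.
\<close>

lemma outdegrees_determine_orientation:
  assumes P: "orientation P" and P': "orientation P'"
    and ad: "admissible P vs" and vs: "set vs = V"
    and eq: "\<And>v. v \<in> V \<Longrightarrow> card (N v - P v) = card (N v - P' v)"
    and v: "v \<in> fst G"
  shows "P v = P' v"
proof -
  have "\<forall>v \<in> set xs. P v = P' v" if "vs = xs @ ys" for xs ys
    using that
  proof (induction xs arbitrary: ys rule: rev_induct)
    case (snoc w xs)
    have IH: "\<forall>v \<in> set xs. P v = P' v"
      using snoc.IH[of "w # ys"] snoc.prems by simp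
    have "w \<in> set vs" unfolding snoc.prems by simp
    hence w: "w \<in> V" unfolding vs .
    hence wG: "w \<in> fst G" by simp
    have "P w \<subseteq> P' w"
    proof
      fix u assume u: "u \<in> P w"
      have "u \<in> insert 0 (set xs)" using admissible_prefix[OF ad, of xs w ys] snoc.prems u by auto
      hence "P u = P' u"
      proof
        assume "u = 0"
        thus ?thesis by (simp only: orientation_sink[OF P] orientation_sink[OF P'])
      qed (rule bspec[OF IH])
      moreover have uN: "u \<in> N w" using orientation_subset[OF P wG] u by (rule subsetD)
      moreover have "w \<notin> P u"
        using orientation_flip[OF P wG uN] u by (rule iffD1)
      ultimately show "u \<in> P' w" using orientation_flip[OF P' wG uN] by (simp only: simp_thms)
    qed
    moreover have "card (P w) = card (P' w)"
      using card_orientation[OF P, of w] card_orientation[OF P', of w] eq[OF w] w by simp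
    moreover have "finite (P' w)"
      using w by (intro finite_subset[OF orientation_subset[OF P'] finite_nbrs]) simp
    ultimately have "P w = P' w" by (rule card_subset_eq[rotated])
    thus ?case using IH by simp
  qed simp
  from this[of vs "[]"] have "\<forall>v \<in> V. P v = P' v" using vs by simp
  thus ?thesis
    using v orientation_sink[OF P] orientation_sink[OF P'] by (cases "v = 0") auto
qed

end

section \<open>The Ferrers graph\<close>

locale ferrers_diagram =
  fixes F :: "nat list"
  assumes ferrers: "ferrers F"
begin

abbreviation "m \<equiv> length F"
abbreviation "w \<equiv> F ! 0"
abbreviation "r i \<equiv> label F (Row i)"
abbreviation "k j \<equiv> label F (Col j)"
abbreviation "G \<equiv> ferrers_graph F"

lemma nonempty [simp]: "F \<noteq> []"
  using ferrers by (simp add: ferrers_def)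

lemma row_length_antimono: "i \<le> i' \<Longrightarrow> i' < m \<Longrightarrow> F ! i' \<le> F ! i"
  using ferrers sorted_wrt_nth_less[of "(\<ge>)" F i i']
  by (cases "i = i'") (auto simp: ferrers_def)

lemma row_length_pos: "i < m \<Longrightarrow> 0 < F ! i"
  using ferrers by (simp add: ferrers_def)

lemma cells_bounds: "(i, j) \<in> cells F \<Longrightarrow> i < m \<and> j < w"
  using row_length_antimono[of 0 i] by (auto simp: cells_def)

lemma top_cells: "(0, j) \<in> cells F \<longleftrightarrow> j < w"
  by (simp add: cells_def)

lemma cells_antimono: "(i', j) \<in> cells F \<Longrightarrow> i \<le> i' \<Longrightarrow> (i, j) \<in> cells F"
  using row_length_antimono[of i i'] by (auto simp: cells_def)

lemma set_border: "set (border F) = Row ` {..<m} \<union> Col ` {..<w}"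
proof -
  let ?g = "\<lambda>i. (F @ [0]) ! i"
  have "\<exists>i \<in> {0..<m}. ?g (Suc i) \<le> j \<and> j < F ! i" if "j < w" for j
  proof -
    \<comment> \<open>The column ends in the last row that is long enough to contain it.\<close>
    define i where "i = (LEAST i. ?g i \<le> j)"
    have "?g m \<le> j" by simp
    hence i: "?g i \<le> j" "i \<le> m" unfolding i_def by (rule LeastI, rule Least_le)
    have "?g 0 = w" by (simp add: nth_append)
    hence "i \<noteq> 0" using i(1) that by (intro notI) simp
    then obtain i' where i': "i = Suc i'" by (cases i) auto
    hence "\<not> ?g i' \<le> j" unfolding i_def by (intro not_less_Least) simp
    moreover have "?g i' = F ! i'" using i(2) i' by (simp add: nth_append)
    ultimately show ?thesis using i i' by (intro bexI[of _ i']) simp_all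
  qed
  moreover have "j < w" if "i < m" "j < F ! i" for i j
    using cells_bounds[of i j] that by (simp add: cells_def)
  ultimately show ?thesis
    unfolding border_def by (auto simp: image_iff)
qed

text \<open>
  Row \<open>i\<close> contributes its own step and the difference to the next row length; the differences
  telescope.
\<close>

lemma length_border: "length (border F) = m + w"
proof -
  let ?g = "\<lambda>i. (F @ [0]) ! i"
  have mono: "?g (Suc i) \<le> ?g i" if "i < m" for i
    using row_length_antimono[of i "Suc i"] that by (auto simp: nth_append)
  have tele: "(\<Sum>i < n. ?g i - ?g (Suc i)) + ?g n = ?g 0" if "n \<le> m" for n
    using that
  proof (induction n)
    case (Suc n)
    thus ?case using mono[of n] by simp
  qed simp
  have "length (border F) = (\<Sum>i < m. 1 + (F ! i - ?g (Suc i)))"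
    unfolding border_def
    by (simp add: length_concat comp_def interv_sum_list_conv_sum_set_nat lessThan_atLeast0)
  also have "\<dots> = (\<Sum>i < m. 1 + (?g i - ?g (Suc i)))"
    by (intro sum.cong) (auto simp: nth_append)
  also have "\<dots> = m + (\<Sum>i < m. ?g i - ?g (Suc i))" by (simp only: sum.distrib) simp
  also have "\<dots> = m + w" using tele[of m] by (simp only: nth_append) simp
  finally show ?thesis .
qed

lemma distinct_border: "distinct (border F)"
proof (rule card_distinct)
  have "card (Row ` {..<m} \<union> Col ` {..<w}) = m + w"
    by (subst card_Un_disjoint) (auto simp: card_image inj_on_def)
  thus "card (set (border F)) = length (border F)" by (simp add: set_border length_border)
qed

lemma maxlabel: "Suc (maxlabel F) = m + w"
  by (simp add: maxlabel_def)

lemma vertices: "fst G = {..<m + w}"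
  using maxlabel by (auto simp: ferrers_graph_def)

lemma label_nth: "l < m + w \<Longrightarrow> label F (border F ! l) = l"
  unfolding label_def using distinct_border
  by (intro the_equality) (auto simp: length_border nth_eq_iff_index_eq)

lemma nth_label: "s \<in> set (border F) \<Longrightarrow> border F ! label F s = s \<and> label F s < m + w"
  using label_nth by (metis in_set_conv_nth length_border)

lemma border_row [simp]: "i < m \<Longrightarrow> border F ! r i = Row i"
  using nth_label by (simp add: set_border)

lemma border_col [simp]: "j < w \<Longrightarrow> border F ! k j = Col j"
  using nth_label by (simp add: set_border)

lemma row_vertex: "i < m \<Longrightarrow> r i \<in> fst G"
  using nth_label[of "Row i"] by (simp add: set_border vertices)

lemma col_vertex: "j < w \<Longrightarrow> k j \<in> fst G"
  using nth_label[of "Col j"] by (simp add: set_border vertices)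

lemma row_inj [simp]: "i < m \<Longrightarrow> i' < m \<Longrightarrow> r i = r i' \<longleftrightarrow> i = i'"
  by (metis border_row step.inject(1))

lemma col_inj [simp]: "j < w \<Longrightarrow> j' < w \<Longrightarrow> k j = k j' \<longleftrightarrow> j = j'"
  by (metis border_col step.inject(2))

lemma row_neq_col [simp]: "i < m \<Longrightarrow> j < w \<Longrightarrow> r i \<noteq> k j \<and> k j \<noteq> r i"
  by (metis border_row border_col step.distinct(1))

lemma row_zero [simp]: "r 0 = 0"
proof -
  have "border F ! 0 = Row 0"
    by (simp add: border_def upt_conv_Cons)
  thus ?thesis using label_nth[of 0] by simp
qed

lemma vertex_cases:
  assumes "v \<in> fst G"
  obtains (row) i where "i < m" "v = r i" | (col) j where "j < w" "v = k j"
proof -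
  have v: "v < m + w" using assms by (simp add: vertices)
  hence "border F ! v \<in> Row ` {..<m} \<union> Col ` {..<w}"
    using set_border nth_mem[of v "border F"] by (simp add: length_border)
  thus thesis using label_nth[OF v] that by (auto dest: sym)
qed

lemma edge_iff: "{u, v} \<in> snd G \<longleftrightarrow>
    (\<exists>i j. (i, j) \<in> cells F \<and> (u = r i \<and> v = k j \<or> u = k j \<and> v = r i))"
  by (auto simp: ferrers_graph_def doubleton_eq_iff)

lemma nbrs_row:
  assumes "i < m"
  shows "nbrs G (r i) = k ` {j. (i, j) \<in> cells F}"
proof -
  have "u \<in> nbrs G (r i) \<longleftrightarrow> u \<in> k ` {j. (i, j) \<in> cells F}" for u
  proof
    assume "u \<in> nbrs G (r i)"
    then obtain i' j where ij: "(i', j) \<in> cells F" "u = r i' \<and> r i = k j \<or> u = k j \<and> r i = r i'"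
      unfolding nbrs_def edge_iff by blast
    thus "u \<in> k ` {j. (i, j) \<in> cells F}"
      using assms cells_bounds[OF ij(1)] by auto
  next
    assume "u \<in> k ` {j. (i, j) \<in> cells F}"
    then obtain j where "(i, j) \<in> cells F" "u = k j" by blast
    thus "u \<in> nbrs G (r i)"
      unfolding nbrs_def edge_iff using cells_bounds col_vertex by blast
  qed
  thus ?thesis by blast
qed

lemma nbrs_col:
  assumes "j < w"
  shows "nbrs G (k j) = r ` {i. (i, j) \<in> cells F}"
proof -
  have "u \<in> nbrs G (k j) \<longleftrightarrow> u \<in> r ` {i. (i, j) \<in> cells F}" for u
  proof
    assume "u \<in> nbrs G (k j)"
    then obtain i j' where ij: "(i, j') \<in> cells F" "u = r i \<and> k j = k j' \<or> u = k j' \<and> k j = r i"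
      unfolding nbrs_def edge_iff by blast
    thus "u \<in> r ` {i. (i, j) \<in> cells F}"
      using assms cells_bounds[OF ij(1)] by auto
  next
    assume "u \<in> r ` {i. (i, j) \<in> cells F}"
    then obtain i where "(i, j) \<in> cells F" "u = r i" by blast
    thus "u \<in> nbrs G (k j)"
      unfolding nbrs_def edge_iff using cells_bounds row_vertex by blast
  qed
  thus ?thesis by blast
qed

lemma nbrs_sink: "nbrs G 0 = k ` {..<w}"
  using nbrs_row[of 0] by (simp add: top_cells lessThan_def)

lemma sink_graph: "sink_graph G"
proof
  show "finite (fst G)" "0 \<in> fst G" by (simp_all add: vertices)
  show "v \<notin> nbrs G v" for v
  proof
    assume v: "v \<in> nbrs G v"
    hence "v \<in> fst G" by (simp add: nbrs_def)
    thus False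
    proof (cases rule: vertex_cases)
      case (row i)
      thus False using v nbrs_row[of i] cells_bounds by auto
    next
      case (col j)
      thus False using v nbrs_col[of j] cells_bounds by auto
    qed
  qed
  show "v \<in> nbrs G 0 \<or> (\<exists>u \<in> nbrs G v. u \<in> nbrs G 0)" if "v \<in> fst G - {0}" for v
  proof -
    from that have "v \<in> fst G" by simp
    thus ?thesis
    proof (cases rule: vertex_cases)
      case (row i)
      have "(i, 0) \<in> cells F" using row row_length_pos by (simp add: cells_def)
      thus ?thesis using row nbrs_row[of i] nbrs_sink cells_bounds by blast
    next
      case (col j)
      thus ?thesis using nbrs_sink by blast
    qed
  qed
qed

end

sublocale ferrers_diagram \<subseteq> sink_graph "ferrers_graph F"
  by (rule sink_graph)

context ferrers_diagram
begin

lemma tilde_fire_sink: "tilde F c = fire_sink c"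
proof
  fix l
  have "is_col_label F l \<longleftrightarrow> l \<in> nbrs G 0"
  proof
    assume "is_col_label F l"
    then obtain j where j: "l < m + w" "border F ! l = Col j"
      by (auto simp: is_col_label_def length_border)
    hence "j < w" using set_border nth_mem[of l "border F"] by (auto simp: length_border)
    thus "l \<in> nbrs G 0" using j label_nth[OF j(1)] by (auto simp: nbrs_sink)
  next
    assume "l \<in> nbrs G 0"
    then obtain j where "j < w" "l = k j" by (auto simp: nbrs_sink)
    thus "is_col_label F l"
      using col_vertex[of j] by (auto simp: is_col_label_def length_border vertices)
  qed
  thus "tilde F c l = fire_sink c l" by (simp add: tilde_def fire_sink_def)
qed

lemma non_sink_vertices: "V = {1..maxlabel F}"
  by (auto simp: ferrers_graph_def)

lemma non_sink_eq: "V = r ` {1..<m} \<union> k ` {..<w}"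
proof (intro equalityI subsetI)
  fix v assume v: "v \<in> V"
  hence "v \<in> fst G" by simp
  thus "v \<in> r ` {1..<m} \<union> k ` {..<w}"
  proof (cases rule: vertex_cases)
    case (row i)
    hence "i \<noteq> 0" using v by (intro notI) simp
    thus ?thesis using row by simp
  qed simp
next
  fix v assume "v \<in> r ` {1..<m} \<union> k ` {..<w}"
  thus "v \<in> V"
  proof
    assume "v \<in> r ` {1..<m}"
    then obtain i where "v = r i" "i < m" "i \<noteq> 0" by auto
    thus ?thesis using row_vertex[of i] row_inj[of i 0] by simp
  next
    assume "v \<in> k ` {..<w}"
    then obtain j where "v = k j" "j < w" by auto
    thus ?thesis using col_vertex[of j] row_neq_col[of 0 j] by simp
  qed
qed

lemma recurrent_iff:
  "c \<in> recurrent F \<longleftrightarrow>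
    c \<in> configs G \<and> stable G c \<and> (\<exists>vs. topples G (fire_sink c) vs c)"
proof -
  have "stabilization G (fire_sink c) = c \<longleftrightarrow>
      stable G c \<and> (\<exists>vs. topples G (fire_sink c) vs c)"
    using stabilization_reached[of "fire_sink c"] stabilization_eqI by auto
  thus ?thesis unfolding recurrent_def mem_Collect_eq tilde_fire_sink by blast
qed

section \<open>Tableaux as acyclic orientations\<close>

text \<open>
  The arrows into a vertex: \<open>0\<close>s are arrows from columns to rows, \<open>1\<close>s arrows from rows to columns.
\<close>

definition preds :: "(nat \<times> nat \<Rightarrow> nat) \<Rightarrow> nat \<Rightarrow> nat set" where
  "preds T v = (case border F ! v of
       Row i \<Rightarrow> k ` {j. (i, j) \<in> cells F \<and> T (i, j) = 0}
     | Col j \<Rightarrow> r ` {i. (i, j) \<in> cells F \<and> T (i, j) = 1})"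

lemma preds_row: "i < m \<Longrightarrow> preds T (r i) = k ` {j. (i, j) \<in> cells F \<and> T (i, j) = 0}"
  by (simp add: preds_def)

lemma preds_col: "j < w \<Longrightarrow> preds T (k j) = r ` {i. (i, j) \<in> cells F \<and> T (i, j) = 1}"
  by (simp add: preds_def)

lemma config_of_row:
  "i < m \<Longrightarrow> 0 < i \<Longrightarrow> config_of F T (r i) = card {j. (i, j) \<in> cells F \<and> T (i, j) = 1}"
  using non_sink_vertices non_sink_eq by (auto simp: config_of_def)

lemma config_of_col:
  "j < w \<Longrightarrow> config_of F T (k j) = card {i. (i, j) \<in> cells F \<and> T (i, j) = 0}"
  using non_sink_vertices non_sink_eq by (auto simp: config_of_def)

lemma preds_row_iff:
  assumes "(i, j) \<in> cells F"
  shows "k j \<in> preds T (r i) \<longleftrightarrow> T (i, j) = 0"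
proof
  assume "k j \<in> preds T (r i)"
  then obtain j' where "(i, j') \<in> cells F" "T (i, j') = 0" "k j = k j'"
    using cells_bounds[OF assms] by (auto simp: preds_row)
  thus "T (i, j) = 0" using cells_bounds[OF assms] cells_bounds[of i j'] by simp
qed (use assms cells_bounds[OF assms] in \<open>auto simp: preds_row\<close>)

lemma preds_col_iff:
  assumes "(i, j) \<in> cells F"
  shows "r i \<in> preds T (k j) \<longleftrightarrow> T (i, j) = 1"
proof
  assume "r i \<in> preds T (k j)"
  then obtain i' where "(i', j) \<in> cells F" "T (i', j) = 1" "r i = r i'"
    using cells_bounds[OF assms] by (auto simp: preds_col)
  thus "T (i, j) = 1" using cells_bounds[OF assms] cells_bounds[of i' j] by simp
qed (use assms cells_bounds[OF assms] in \<open>auto simp: preds_col\<close>)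

lemma EW_extensional: "T \<in> EW_tableaux F \<Longrightarrow> T \<in> cells F \<rightarrow>\<^sub>E {0, 1}"
  unfolding EW_tableaux_def mem_Collect_eq by (elim conjE)

lemma EW_values: "T \<in> EW_tableaux F \<Longrightarrow> (i, j) \<in> cells F \<Longrightarrow> T (i, j) \<in> {0, 1}"
  by (rule PiE_mem[OF EW_extensional])

lemma EW_top_row:
  assumes "T \<in> EW_tableaux F" "j < w"
  shows "T (0, j) = 1"
proof -
  have "\<forall>j < w. T (0, j) = 1"
    using assms(1) unfolding EW_tableaux_def mem_Collect_eq by (elim conjE)
  thus ?thesis using assms(2) by simp
qed

lemma EW_row_zero:
  assumes "T \<in> EW_tableaux F" "0 < i" "i < m"
  shows "\<exists>j. (i, j) \<in> cells F \<and> T (i, j) = 0"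
proof -
  have "\<forall>i. 0 < i \<and> i < m \<longrightarrow> (\<exists>j < F ! i. T (i, j) = 0)"
    using assms(1) unfolding EW_tableaux_def mem_Collect_eq by (elim conjE)
  thus ?thesis using assms(2,3) by (auto simp: cells_def)
qed

lemma EW_rectangle:
  assumes "T \<in> EW_tableaux F"
    and "(i, j) \<in> cells F" "(i, j') \<in> cells F" "(i', j) \<in> cells F" "(i', j') \<in> cells F"
    and "T (i, j) = 0" "T (i', j') = 0" "T (i, j') = 1" "T (i', j) = 1"
  shows False
proof -
  have "i \<noteq> i'" "j \<noteq> j'" using assms(6-9) by auto
  hence "\<exists>i i' j j'. i \<noteq> i' \<and> j \<noteq> j' \<and>
      {(i, j), (i, j'), (i', j), (i', j')} \<subseteq> cells F \<and>
      T (i, j) = 0 \<and> T (i', j') = 0 \<and> T (i, j') = 1 \<and> T (i', j) = 1"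
    using assms(2-9)
    by (intro exI[of _ i] exI[of _ i'] exI[of _ j] exI[of _ j'] conjI) simp_all
  with assms(1) show False
    unfolding EW_tableaux_def mem_Collect_eq by (elim conjE) (erule notE)
qed

lemma config_of_outdegree:
  assumes "T \<in> EW_tableaux F" and "v \<in> V"
  shows "config_of F T v = card (N v - preds T v)"
proof -
  note T = EW_values[OF assms(1)]
  from assms(2) consider (row) i where "i < m" "0 < i" "v = r i" | (col) j where "j < w" "v = k j"
    unfolding non_sink_eq by fastforce
  thus ?thesis
  proof cases
    case row
    have "N v - preds T v = k ` {j. (i, j) \<in> cells F \<and> T (i, j) = 1}"
    proof (intro equalityI subsetI)
      fix u assume u: "u \<in> N v - preds T v"
      then obtain j where j: "(i, j) \<in> cells F" "u = k j" using row nbrs_row by auto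
      hence "T (i, j) \<noteq> 0" using u row preds_row_iff by auto
      thus "u \<in> k ` {j. (i, j) \<in> cells F \<and> T (i, j) = 1}" using T[OF j(1)] j by auto
    next
      fix u assume "u \<in> k ` {j. (i, j) \<in> cells F \<and> T (i, j) = 1}"
      then obtain j where "(i, j) \<in> cells F" "u = k j" "T (i, j) = 1" by auto
      thus "u \<in> N v - preds T v" using row nbrs_row preds_row_iff by auto
    qed
    moreover have "inj_on k {j. (i, j) \<in> cells F \<and> T (i, j) = 1}"
      using cells_bounds by (auto intro!: inj_onI dest!: cells_bounds)
    ultimately show ?thesis using row by (simp add: config_of_row card_image)
  next
    case col
    have "N v - preds T v = r ` {i. (i, j) \<in> cells F \<and> T (i, j) = 0}"
    proof (intro equalityI subsetI)
      fix u assume u: "u \<in> N v - preds T v"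
      then obtain i where i: "(i, j) \<in> cells F" "u = r i" using col nbrs_col by auto
      hence "T (i, j) \<noteq> 1" using u col preds_col_iff by auto
      thus "u \<in> r ` {i. (i, j) \<in> cells F \<and> T (i, j) = 0}" using T[OF i(1)] i by auto
    next
      fix u assume "u \<in> r ` {i. (i, j) \<in> cells F \<and> T (i, j) = 0}"
      then obtain i where "(i, j) \<in> cells F" "u = r i" "T (i, j) = 0" by auto
      thus "u \<in> N v - preds T v" using col nbrs_col preds_col_iff by auto
    qed
    moreover have "inj_on r {i. (i, j) \<in> cells F \<and> T (i, j) = 0}"
      using cells_bounds by (auto intro!: inj_onI dest!: cells_bounds)
    ultimately show ?thesis using col by (simp add: config_of_col card_image)
  qed
qed

lemma orientation_preds:
  assumes T: "T \<in> EW_tableaux F"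
  shows "orientation (preds T)"
  unfolding orientation_def
proof (intro conjI ballI)
  have "preds T (r 0) = {}"
    using EW_top_row[OF T] by (subst preds_row) (auto simp: top_cells)
  thus "preds T 0 = {}" by simp
next
  fix v assume "v \<in> fst G"
  thus "preds T v \<subseteq> N v"
    by (cases rule: vertex_cases) (auto simp: preds_row preds_col nbrs_row nbrs_col)
next
  fix v u assume v: "v \<in> fst G" and u: "u \<in> N v"
  from v show "u \<in> preds T v \<longleftrightarrow> v \<notin> preds T u"
  proof (cases rule: vertex_cases)
    case (row i)
    then obtain j where j: "(i, j) \<in> cells F" "u = k j" using u nbrs_row by auto
    show ?thesis
      unfolding row(2) j(2) preds_row_iff[OF j(1)] preds_col_iff[OF j(1)]
      using EW_values[OF T j(1)] by auto
  next
    case (col j)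
    then obtain i where i: "(i, j) \<in> cells F" "u = r i" using u nbrs_col by auto
    show ?thesis
      unfolding col(2) i(2) preds_row_iff[OF i(1)] preds_col_iff[OF i(1)]
      using EW_values[OF T i(1)] by auto
  qed
qed

section \<open>The reading procedure\<close>

text \<open>
  This is the acyclicity of the orientation: rows and columns that each have an incoming arrow from
  within the selection would contain a directed cycle. The Ferrers shape enters through the lowest
  row \<open>b\<close>: the part of the selection within its columns \<open>C'\<close> is a full rectangle. As no forbidden
  rectangles occur there, the sets of \<open>1\<close>s of the rows form a chain, and the largest one is all
  of \<open>C'\<close>, because every column has a \<open>1\<close>. So \<open>b\<close>, which has a \<open>0\<close> in \<open>C'\<close>, can be discarded
  without taking away the last \<open>1\<close> of any column.
\<close>

lemma EW_subtableau_column: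
  assumes T: "T \<in> EW_tableaux F" and "finite R"
    and "\<forall>i \<in> R. \<exists>j \<in> C. (i, j) \<in> cells F \<and> T (i, j) = 0"
    and "\<forall>j \<in> C. \<exists>i \<in> R. (i, j) \<in> cells F \<and> T (i, j) = 1"
  shows "C = {}"
  using assms(2-)
proof (induction R rule: finite_linorder_max_induct)
  case empty
  thus ?case by blast
next
  case (insert b R)
  define C' where "C' = {j \<in> C. j < F ! b}"
  obtain j0 where j0: "j0 \<in> C" "(b, j0) \<in> cells F" "T (b, j0) = 0" using insert.prems(1) by blast
  have cell: "(i, j) \<in> cells F" if "i \<in> insert b R" "j \<in> C'" for i j
  proof -
    have "i \<le> b" using insert.hyps that(1) by auto
    moreover have "(b, j) \<in> cells F" using j0(2) that(2) by (simp add: C'_def cells_def)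
    ultimately show ?thesis by (rule cells_antimono[rotated])
  qed
  define ones where "ones = (\<lambda>i. {j \<in> C'. T (i, j) = 1})"
  have fin: "finite C'" unfolding C'_def by simp
  have "card (ones i) < Suc (card C')" for i
    unfolding ones_def less_Suc_eq_le by (intro card_mono fin) blast
  then obtain i0 where i0: "i0 \<in> insert b R" and
    max: "\<And>i. i \<in> insert b R \<Longrightarrow> card (ones i) \<le> card (ones i0)"
    using ex_has_greatest_nat[of "\<lambda>i. i \<in> insert b R" b "\<lambda>i. card (ones i)" "Suc (card C')"]
    by auto
  have full: "T (i0, j) = 1" if j: "j \<in> C'" for j
  proof (rule ccontr)
    assume "T (i0, j) \<noteq> 1"
    hence zero: "T (i0, j) = 0" using EW_values[OF T cell[OF i0 j]] by simp
    have "j \<in> C" using j by (simp add: C'_def)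
    then obtain i where i: "i \<in> insert b R" "T (i, j) = 1" using insert.prems(2) by blast
    have "\<not> ones i0 \<subset> ones i"
      using psubset_card_mono[of "ones i" "ones i0"] max[OF i(1)] fin
      by (auto simp: ones_def)
    moreover have "j \<in> ones i" "j \<notin> ones i0" using i j zero by (simp_all add: ones_def)
    ultimately obtain j' where "j' \<in> ones i0" "j' \<notin> ones i" by blast
    hence j': "j' \<in> C'" "T (i0, j') = 1" "T (i, j') \<noteq> 1" by (simp_all add: ones_def)
    hence "T (i, j') = 0" using EW_values[OF T cell[OF i(1) j'(1)]] by simp
    thus False
      using EW_rectangle[OF T cell[OF i0 j] cell[OF i0 j'(1)] cell[OF i(1) j] cell[OF i(1) j'(1)]]
        zero i(2) j'(2) by simp
  qed
  have "j0 \<in> C'" using j0 by (simp add: C'_def cells_def)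
  hence "i0 \<noteq> b" using full j0(3) by (intro notI) simp
  hence i0R: "i0 \<in> R" using i0 by simp
  have "\<exists>i \<in> R. (i, j) \<in> cells F \<and> T (i, j) = 1" if j: "j \<in> C" for j
  proof (cases "j \<in> C'")
    case True
    thus ?thesis using cell[OF i0] full i0R by blast
  next
    case False
    hence "(b, j) \<notin> cells F" using j by (simp add: C'_def cells_def)
    thus ?thesis using insert.prems(2) j by blast
  qed
  thus ?case using insert.IH insert.prems(1) by blast
qed

text \<open>
  The invariant of the reading procedure: the labels \<open>xs\<close> are exactly those that are no longer
  unread, and they are in topological order. That each unread row keeps a \<open>0\<close> in an unread column is
  what lets \<open>EW_subtableau_column\<close> find the next column to read.
\<close>

definition reading :: "(nat \<times> nat \<Rightarrow> nat) \<Rightarrow> nat list \<times> nat list \<times> nat list \<Rightarrow> bool" where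
  "reading T = (\<lambda>(rs, cs, xs).
     distinct rs \<and> distinct cs \<and> set rs \<subseteq> {1..<m} \<and> set cs \<subseteq> {..<w} \<and>
     distinct xs \<and> set xs \<subseteq> V \<and>
     (\<forall>i \<in> {1..<m}. r i \<in> set xs \<longleftrightarrow> i \<notin> set rs) \<and>
     (\<forall>j \<in> {..<w}. k j \<in> set xs \<longleftrightarrow> j \<notin> set cs) \<and>
     admissible (preds T) xs \<and>
     (\<forall>i \<in> set rs. \<exists>j \<in> set cs. (i, j) \<in> cells F \<and> T (i, j) = 0))"

text \<open>
  A column is read when all its \<open>1\<close>s lie in rows already read or in the top row, a row when all its
  \<open>0\<close>s lie in columns already read, including those read in the same round.
\<close>

lemma reading_round:
  assumes T: "T \<in> EW_tableaux F" and "reading T (rs, cs, xs)"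
  shows "reading T (Psi_round F T (rs, cs, xs))"
proof -
  define no1 where "no1 = (\<lambda>j. \<forall>i \<in> set rs. (i, j) \<in> cells F \<longrightarrow> T (i, j) \<noteq> 1)"
  define cs' where "cs' = filter (\<lambda>j. \<not> no1 j) cs"
  define no0 where "no0 = (\<lambda>i. \<forall>j \<in> set cs'. (i, j) \<in> cells F \<longrightarrow> T (i, j) \<noteq> 0)"
  define rs' where "rs' = filter (\<lambda>i. \<not> no0 i) rs"
  define A where "A = map k (filter no1 cs)"
  define B where "B = map r (filter no0 rs)"
  have round: "Psi_round F T (rs, cs, xs) = (rs', cs', xs @ A @ B)"
    by (simp add: Psi_round_def Let_def no1_def cs'_def no0_def rs'_def A_def B_def)
  have dist: "distinct rs" "distinct cs" "distinct xs"
    and rs: "set rs \<subseteq> {1..<m}" and cs: "set cs \<subseteq> {..<w}" and xs: "set xs \<subseteq> V"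
    and r_iff: "\<And>i. i \<in> {1..<m} \<Longrightarrow> r i \<in> set xs \<longleftrightarrow> i \<notin> set rs"
    and k_iff: "\<And>j. j \<in> {..<w} \<Longrightarrow> k j \<in> set xs \<longleftrightarrow> j \<notin> set cs"
    and ad: "admissible (preds T) xs"
    using assms(2) by (auto simp: reading_def)
  have A: "k j \<in> set A \<longleftrightarrow> j \<in> set cs \<and> no1 j" if "j \<in> {..<w}" for j
    using that cs by (auto simp: A_def)
  have B: "r i \<in> set B \<longleftrightarrow> i \<in> set rs \<and> no0 i" if "i \<in> {1..<m}" for i
    using that rs by (auto simp: B_def)
  have neq: "k j \<noteq> r i" if "j \<in> set cs" "i \<in> set rs" for i j
    using row_neq_col[of i j] subsetD[OF rs, of i] subsetD[OF cs, of j] that by simp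
  have "inj_on k {..<w}" "inj_on r {1..<m}" by (auto intro!: inj_onI)
  hence "inj_on k (set (filter no1 cs))" "inj_on r (set (filter no0 rs))"
    using cs rs by (auto elim!: inj_on_subset)
  hence "distinct A" "distinct B" unfolding A_def B_def distinct_map using dist by simp_all
  moreover have "set A \<inter> set B = {}" using neq by (auto simp: A_def B_def)
  moreover have "set xs \<inter> set A = {}" using cs k_iff by (auto simp: A_def)
  moreover have "set xs \<inter> set B = {}" using rs r_iff by (auto simp: B_def)
  ultimately have "distinct (xs @ A @ B)" using dist(3) by auto
  moreover have "set (xs @ A @ B) \<subseteq> V"
    using xs rs cs unfolding non_sink_eq by (auto simp: A_def B_def)
  moreover have "r i \<in> set (xs @ A @ B) \<longleftrightarrow> i \<notin> set rs'" if "i \<in> {1..<m}" for i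
  proof -
    have "r i \<notin> set A" using that cs by (auto simp: A_def)
    thus ?thesis using B[OF that] r_iff[OF that] by (auto simp: rs'_def)
  qed
  moreover have "k j \<in> set (xs @ A @ B) \<longleftrightarrow> j \<notin> set cs'" if "j \<in> {..<w}" for j
  proof -
    have "k j \<notin> set B" using that rs by (auto simp: B_def)
    thus ?thesis using A[OF that] k_iff[OF that] by (auto simp: cs'_def)
  qed
  moreover have "admissible (preds T) (xs @ A @ B)"
    unfolding append_assoc[symmetric]
  proof (intro admissible_append ad)
    fix v assume "v \<in> set A"
    then obtain j where j: "v = k j" "j \<in> set cs" "no1 j" by (auto simp: A_def)
    have "r i \<in> insert 0 (set xs)" if i: "(i, j) \<in> cells F" "T (i, j) = 1" for i
    proof (cases "i = 0")
      case False
      hence "i \<in> {1..<m}" using cells_bounds[OF i(1)] by simp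
      moreover have "i \<notin> set rs" using j(3) i by (auto simp: no1_def)
      ultimately show ?thesis using r_iff by simp
    qed simp
    moreover have "j < w" using j(2) cs by auto
    ultimately show "preds T v \<subseteq> insert 0 (set xs)" unfolding j(1) by (auto simp: preds_col)
  next
    fix v assume "v \<in> set B"
    then obtain i where i: "v = r i" "i \<in> set rs" "no0 i" by (auto simp: B_def)
    have "k j \<in> set (xs @ A)" if j: "(i, j) \<in> cells F" "T (i, j) = 0" for j
    proof -
      have "j \<in> {..<w}" using cells_bounds[OF j(1)] by simp
      moreover have "j \<notin> set cs'" using i(3) j by (auto simp: no0_def)
      ultimately show ?thesis using k_iff[of j] A[of j] by (auto simp: cs'_def)
    qed
    moreover have "i < m" using i(2) rs by auto
    ultimately show "preds T v \<subseteq> insert 0 (set (xs @ A))"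
      unfolding i(1) by (auto simp: preds_row)
  qed
  moreover have "\<exists>j \<in> set cs'. (i, j) \<in> cells F \<and> T (i, j) = 0" if "i \<in> set rs'" for i
    using that by (auto simp: rs'_def no0_def)
  moreover have "distinct rs'" "distinct cs'" "set rs' \<subseteq> {1..<m}" "set cs' \<subseteq> {..<w}"
    using dist rs cs by (auto simp: rs'_def cs'_def)
  ultimately show ?thesis
    unfolding round reading_def prod.case by (intro conjI ballI) blast+
qed

lemma reading_progress:
  assumes T: "T \<in> EW_tableaux F" and I: "reading T (rs, cs, xs)" and "rs \<noteq> [] \<or> cs \<noteq> []"
  shows "length (fst (snd (Psi_round F T (rs, cs, xs)))) < length cs"
proof -
  have zeros: "\<forall>i \<in> set rs. \<exists>j \<in> set cs. (i, j) \<in> cells F \<and> T (i, j) = 0"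
    using I unfolding reading_def prod.case by (elim conjE)
  have "cs \<noteq> []"
  proof
    assume "cs = []"
    with zeros have "rs = []" by (cases rs) auto
    with \<open>cs = []\<close> assms(3) show False by simp
  qed
  have "\<exists>j \<in> set cs. \<forall>i \<in> set rs. (i, j) \<in> cells F \<longrightarrow> T (i, j) \<noteq> 1"
  proof (rule ccontr)
    assume "\<not> ?thesis"
    hence "\<forall>j \<in> set cs. \<exists>i \<in> set rs. (i, j) \<in> cells F \<and> T (i, j) = 1" by blast
    from EW_subtableau_column[OF T _ zeros this] \<open>cs \<noteq> []\<close> show False by simp
  qed
  then obtain j where "j \<in> set cs" "\<forall>i \<in> set rs. (i, j) \<in> cells F \<longrightarrow> T (i, j) \<noteq> 1" by blast
  thus ?thesis
    by (simp add: Psi_round_def Let_def) (rule length_filter_less[of j], simp, blast)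
qed

lemma Psi_order:
  assumes T: "T \<in> EW_tableaux F"
  shows "distinct (Psi F T) \<and> set (Psi F T) = V \<and> admissible (preds T) (Psi F T)"
  unfolding Psi_def
proof (rule while_rule[where P = "reading T" and r = "measure (\<lambda>(rs, cs, xs). length cs)"])
  have "\<exists>j \<in> {0..<w}. (i, j) \<in> cells F \<and> T (i, j) = 0" if "i \<in> {1..<m}" for i
    using EW_row_zero[OF T, of i] that cells_bounds by fastforce
  thus "reading T (rev [1..<m], rev [0..<w], [])"
    by (auto simp: reading_def admissible_def)
next
  fix s assume "reading T s"
  thus "reading T (Psi_round F T s)"
    using reading_round[OF T] by (cases s) blast
next
  fix s assume s: "reading T s" "\<not> (case s of (rs, cs, xs) \<Rightarrow> rs \<noteq> [] \<or> cs \<noteq> [])"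
  then obtain xs where xs: "s = ([], [], xs)" by (cases s) auto
  have "distinct xs" "set xs \<subseteq> V" "admissible (preds T) xs"
    and "\<forall>i \<in> {1..<m}. r i \<in> set xs" "\<forall>j \<in> {..<w}. k j \<in> set xs"
    using s(1) by (simp_all add: xs reading_def)
  moreover from this(4,5) have "V \<subseteq> set xs" unfolding non_sink_eq by blast
  ultimately show "distinct (snd (snd s)) \<and> set (snd (snd s)) = V \<and>
      admissible (preds T) (snd (snd s))"
    by (simp add: xs subset_antisym)
next
  fix s assume s: "reading T s" "case s of (rs, cs, xs) \<Rightarrow> rs \<noteq> [] \<or> cs \<noteq> []"
  obtain rs cs xs where eq: "s = (rs, cs, xs)" by (cases s)
  have "length (fst (snd (Psi_round F T s))) < length cs"
    using reading_progress[OF T, of rs cs xs] s by (simp add: eq)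
  thus "(Psi_round F T s, s) \<in> measure (\<lambda>(rs, cs, xs). length cs)"
    by (simp add: eq split_beta)
qed simp

section \<open>The bijection\<close>

lemma Psi_topples:
  assumes T: "T \<in> EW_tableaux F"
  shows "topples G (fire_sink (config_of F T)) (Psi F T) (config_of F T)"
  using Psi_order[OF T] config_of_outdegree[OF T]
  by (intro outdegree_topples[OF orientation_preds[OF T]]) simp_all

lemma config_of_recurrent:
  assumes T: "T \<in> EW_tableaux F"
  shows "config_of F T \<in> recurrent F"
proof -
  have "config_of F T v < d v" if v: "v \<in> V" for v
  proof -
    have "preds T v \<noteq> {}"
    proof -
      from v consider (row) i where "i < m" "0 < i" "v = r i" | (col) j where "j < w" "v = k j"
        unfolding non_sink_eq by fastforce
      thus ?thesis
      proof cases
        case row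
        thus ?thesis using EW_row_zero[OF T row(2,1)] by (auto simp: preds_row)
      next
        case col
        hence "(0, j) \<in> cells F \<and> T (0, j) = 1" using EW_top_row[OF T] top_cells by simp
        thus ?thesis using col by (auto simp: preds_col)
      qed
    qed
    moreover have "preds T v \<subseteq> N v"
      using orientation_subset[OF orientation_preds[OF T]] v by simp
    ultimately have "N v - preds T v \<subset> N v" by blast
    thus ?thesis
      using psubset_card_mono[OF finite_nbrs] v config_of_outdegree[OF T]
      by (simp add: degree_def)
  qed
  hence "stable G (config_of F T)" by (simp add: stable_def)
  moreover have "config_of F T \<in> configs G"
    unfolding configs_def non_sink_vertices by (simp add: config_of_def)
  ultimately show ?thesis using Psi_topples[OF T] by (auto simp: recurrent_iff)
qed

lemma config_of_inj: "inj_on (config_of F) (EW_tableaux F)"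
proof (rule inj_onI)
  fix T T' assume T: "T \<in> EW_tableaux F" and T': "T' \<in> EW_tableaux F"
    and eq: "config_of F T = config_of F T'"
  have P: "preds T v = preds T' v" if "v \<in> fst G" for v
  proof (rule outdegrees_determine_orientation[OF orientation_preds[OF T] orientation_preds[OF T']])
    show "admissible (preds T) (Psi F T)" "set (Psi F T) = V" using Psi_order[OF T] by simp_all
    show "card (N v - preds T v) = card (N v - preds T' v)" if "v \<in> V" for v
      using config_of_outdegree[OF T that] config_of_outdegree[OF T' that] eq
      by simp
  qed (rule that)
  show "T = T'"
  proof (rule PiE_ext[OF EW_extensional[OF T] EW_extensional[OF T']])
    fix p assume p: "p \<in> cells F"
    obtain i j where ij: "p = (i, j)" by (cases p)
    have cell: "(i, j) \<in> cells F" using p ij by simp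
    hence "preds T (r i) = preds T' (r i)" using P row_vertex cells_bounds by simp
    hence "T (i, j) = 0 \<longleftrightarrow> T' (i, j) = 0"
      using preds_row_iff[OF cell, of T] preds_row_iff[OF cell, of T'] by simp
    thus "T p = T' p"
      using EW_values[OF T, of i j] EW_values[OF T', of i j] cell ij by auto
  qed
qed

lemma config_of_sum:
  assumes "T \<in> EW_tableaux F" "T' \<in> EW_tableaux F"
  shows "sum (config_of F T) V = sum (config_of F T') V"
proof -
  have "sum (config_of F S) V = (\<Sum>v \<in> V. card (N v - preds S v))" if "S \<in> EW_tableaux F" for S
    by (intro sum.cong refl config_of_outdegree[OF that])
  thus ?thesis
    using sum_outdegrees_eq[OF assms[THEN orientation_preds]] assms by simp
qed

text \<open>
  \<open>T\<close> records which of the row and the column of a cell topples first. A vertex \<open>v\<close> that can topple at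
  its turn has at least as many grains as neighbours that come later. In particular, as \<open>c\<close> is stable,
  some neighbour comes earlier, which yields the \<open>0\<close> in a row of \<open>T\<close>. In a forbidden rectangle four
  vertices would each topple before the next one, in a cycle.
\<close>

lemma recurrent_dominates_tableau:
  assumes c: "c \<in> recurrent F"
  obtains T where "T \<in> EW_tableaux F" "\<And>v. v \<in> V \<Longrightarrow> config_of F T v \<le> c v"
proof -
  obtain vs where tc: "topples G (fire_sink c) vs c" and st: "stable G c"
    using c unfolding recurrent_iff by (elim conjE exE)
  have vs: "distinct vs" "set vs = V" using recurrent_topples_once[OF tc st] by simp_all
  have "distinct (0 # vs)" using vs by simp
  from distinct_list_position[OF this] obtain p :: "nat \<Rightarrow> nat"
    where "\<forall>as v bs u. 0 # vs = as @ v # bs \<longrightarrow> u \<in> set as \<longrightarrow> p u < p v" ..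
  note pos = this[rule_format]
  define T where "T = (\<lambda>(i, j) \<in> cells F. if p (r i) < p (k j) then 1 else 0 :: nat)"
  have T_val: "T (i, j) = (if p (r i) < p (k j) then 1 else 0)" if "(i, j) \<in> cells F" for i j
    using that by (simp add: T_def)
  have T_zero: "p (k j) \<le> p (r i)" if "(i, j) \<in> cells F" "T (i, j) = 0" for i j
    using that(2) unfolding T_val[OF that(1)] by (cases "p (r i) < p (k j)") simp_all
  have T_one: "p (r i) < p (k j)" if "(i, j) \<in> cells F" "T (i, j) = 1" for i j
    using that(2) unfolding T_val[OF that(1)] by (cases "p (r i) < p (k j)") simp_all
  have earlier: "u \<in> preds T v" if v: "v \<in> V" and u: "u \<in> N v" "p u < p v" for u v
  proof -
    from v have "v \<in> fst G" by simp
    thus ?thesis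
    proof (cases rule: vertex_cases)
      case (row i)
      then obtain j where j: "(i, j) \<in> cells F" "u = k j" using u(1) nbrs_row by auto
      hence "T (i, j) = 0" using T_val[OF j(1)] u(2) row(2) by simp
      thus ?thesis unfolding row(2) j(2) preds_row_iff[OF j(1)] .
    next
      case (col j)
      then obtain i where i: "(i, j) \<in> cells F" "u = r i" using u(1) nbrs_col by auto
      hence "T (i, j) = 1" using T_val[OF i(1)] u(2) col(2) by simp
      thus ?thesis unfolding col(2) i(2) preds_col_iff[OF i(1)] .
    qed
  qed
  have bound: "card (N v - preds T v) \<le> c v" if v: "v \<in> V" for v
  proof -
    have "v \<in> set vs" using v vs(2) by simp
    from split_list[OF this] obtain xs ys where split: "vs = xs @ v # ys" by (elim exE)
    have "topples G (fire_sink c) (xs @ v # ys) c" using tc unfolding split .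
    then obtain b where b: "topples G (fire_sink c) xs b" "d v \<le> b v"
      unfolding topples_append topples_Cons_iff by (elim exE conjE)
    have xs: "distinct xs" "v \<notin> set xs" using vs(1) split by simp_all
    have "d v \<le> fire_sink c v + card (N v \<inter> set xs)"
      using topples_balance[OF b(1) v] b(2) xs by (simp add: sum_count_distinct)
    moreover have "N v \<inter> insert 0 (set xs) \<subseteq> preds T v"
    proof
      fix u assume u: "u \<in> N v \<inter> insert 0 (set xs)"
      have "0 # vs = (0 # xs) @ v # ys" using split by simp
      from pos[OF this, of u] have "p u < p v" using u by simp
      thus "u \<in> preds T v" using u by (intro earlier[OF v]) simp_all
    qed
    hence "card (N v - preds T v) \<le> card (N v - insert 0 (set xs))"
      by (intro card_mono) auto
    moreover have "card (N v - {0}) = card (N v \<inter> set xs) + card (N v - insert 0 (set xs))"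
    proof -
      have "(N v - {0}) \<inter> set xs = N v \<inter> set xs" "(N v - {0}) - set xs = N v - insert 0 (set xs)"
        using topples_vertices[OF b(1)] by auto
      thus ?thesis using card_Int_Diff[of "N v - {0}" "set xs"] by simp
    qed
    ultimately show ?thesis
      using card_nbrs_sink[OF v] by (simp add: degree_def fire_sink_def split: if_splits)
  qed
  have p0: "p 0 < p v" if v: "v \<in> V" for v
  proof -
    have "v \<in> set vs" using v vs(2) by simp
    from split_list[OF this] obtain xs ys where split: "vs = xs @ v # ys" by (elim exE)
    have "0 # vs = (0 # xs) @ v # ys" using split by simp
    from pos[OF this, of 0] show ?thesis by simp
  qed
  have "T \<in> EW_tableaux F"
    unfolding EW_tableaux_def mem_Collect_eq
  proof (intro conjI allI impI notI)
    show "T \<in> cells F \<rightarrow>\<^sub>E {0, 1}" unfolding T_def by (auto simp: restrict_PiE_iff split: if_splits)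
  next
    fix j assume "j < w"
    moreover from this have "k j \<in> V" unfolding non_sink_eq by simp
    ultimately show "T (0, j) = 1" using p0 T_val[of 0 j] top_cells by simp
  next
    fix i assume i: "0 < i \<and> i < m"
    hence v: "r i \<in> V" unfolding non_sink_eq by simp
    have "preds T (r i) \<noteq> {}"
      using bound[OF v] bspec[OF st[unfolded stable_def] v] by (auto simp: degree_def)
    thus "\<exists>j < F ! i. T (i, j) = 0" using i by (auto simp: preds_row cells_def)
  next
    assume "\<exists>i i' j j'. i \<noteq> i' \<and> j \<noteq> j' \<and>
        {(i, j), (i, j'), (i', j), (i', j')} \<subseteq> cells F \<and>
        T (i, j) = 0 \<and> T (i', j') = 0 \<and> T (i, j') = 1 \<and> T (i', j) = 1"
    thus False
    proof (elim exE conjE)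
      fix i i' j j'
      assume "{(i, j), (i, j'), (i', j), (i', j')} \<subseteq> cells F"
        and val: "T (i, j) = 0" "T (i', j') = 0" "T (i, j') = 1" "T (i', j) = 1"
      hence cell: "(i, j) \<in> cells F" "(i, j') \<in> cells F" "(i', j) \<in> cells F" "(i', j') \<in> cells F"
        by simp_all
      show False
        using T_zero[OF cell(1) val(1)] T_one[OF cell(2) val(3)]
          T_zero[OF cell(4) val(2)] T_one[OF cell(3) val(4)] by linarith
    qed
  qed
  note EW = this
  have "config_of F T v \<le> c v" if v: "v \<in> V" for v
    using bound[OF v] config_of_outdegree[OF EW v] by simp
  with EW show thesis by (rule that)
qed

text \<open>
  Every recurrent configuration lies above some \<open>c(T)\<close>, and all \<open>c(T)\<close> have the same total.
\<close>

lemma minimal_recurrent_eq: "minimal_recurrent F = config_of F ` EW_tableaux F"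
proof (intro equalityI subsetI)
  fix c assume "c \<in> minimal_recurrent F"
  hence c: "c \<in> recurrent F" and min: "\<And>c'. c' \<in> recurrent F \<Longrightarrow> sum c V \<le> sum c' V"
    by (simp_all add: minimal_recurrent_def non_sink_vertices)
  obtain T where T: "T \<in> EW_tableaux F" "\<And>v. v \<in> V \<Longrightarrow> config_of F T v \<le> c v"
    using recurrent_dominates_tableau[OF c] by blast
  have "sum c V \<le> sum (config_of F T) V" by (rule min[OF config_of_recurrent[OF T(1)]])
  hence not_less: "\<not> sum (config_of F T) V < sum c V" by simp
  have eq: "config_of F T v = c v" if v: "v \<in> V" for v
  proof (rule ccontr)
    assume "config_of F T v \<noteq> c v"
    hence "config_of F T v < c v" using T(2)[OF v] by simp
    hence "sum (config_of F T) V < sum c V"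
      using T(2) v finite_vertices by (intro sum_strict_mono_ex1) auto
    thus False using not_less by blast
  qed
  have "config_of F T \<in> V \<rightarrow>\<^sub>E UNIV" "c \<in> V \<rightarrow>\<^sub>E UNIV"
    using c config_of_recurrent[OF T(1)] by (simp_all add: recurrent_iff configs_def)
  hence "config_of F T = c" using eq by (rule PiE_ext)
  thus "c \<in> config_of F ` EW_tableaux F" using T(1) by blast
next
  fix c assume "c \<in> config_of F ` EW_tableaux F"
  then obtain T where T: "T \<in> EW_tableaux F" "c = config_of F T" by blast
  have "sum c V \<le> sum c' V" if c': "c' \<in> recurrent F" for c'
  proof -
    obtain T' where T': "T' \<in> EW_tableaux F" "\<And>v. v \<in> V \<Longrightarrow> config_of F T' v \<le> c' v"
      using recurrent_dominates_tableau[OF c'] by blast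
    have "sum c V = sum (config_of F T') V" using config_of_sum[OF T(1) T'(1)] T(2) by simp
    also have "\<dots> \<le> sum c' V" using T'(2) by (rule sum_mono)
    finally show ?thesis .
  qed
  thus "c \<in> minimal_recurrent F"
    using config_of_recurrent[OF T(1)] T(2)
    by (simp add: minimal_recurrent_def non_sink_vertices)
qed

end

theorem theorem7p1:
  fixes F :: "nat list"
  assumes "ferrers F"
  shows "bij_betw (config_of F) (EW_tableaux F) (minimal_recurrent F) \<and>
    (\<forall>T \<in> EW_tableaux F.
       topples (ferrers_graph F) (tilde F (config_of F T)) (Psi F T) (config_of F T))"
proof -
  interpret ferrers_diagram F using assms by unfold_locales
  show ?thesis
    using config_of_inj Psi_topples
    by (simp add: bij_betw_def minimal_recurrent_eq tilde_fire_sink)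
qed

end
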